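(* Let $(X,\|\cdot\|)$ be a real Banach space, $\varepsilon>0$, and let $f\in\Gamma(X)$ be $\varepsilon$-uniformly convex. Then there exists an equivalent norm $|\!|\!|\cdot|\!|\!|$ on $X$ such that the function $x\mapsto|\!|\!|x|\!|\!|^2$ is $\varepsilon^+$-uniformly convex on the subsets of $\operatorname{dom}(f)$ where $f$ is bounded above; that is, for every $A\subset\operatorname{dom}(f)$ with $\sup_A f<+\infty$ and every $\varepsilon'>\varepsilon$ there is $\delta>0$ such that $$\left|\!\left|\!\left|\frac{x+y}{2}\right|\!\right|\!\right|^2\le\frac{|\!|\!|x|\!|\!|^2+|\!|\!|y|\!|\!|^2}{2}-\delta\quad\text{whenever } x,y\in A,\ \|x-y\|\ge\varepsilon'.$$ Moreover, the norm $|\!|\!|\cdot|\!|\!|$ can be taken as close to $\|\cdot\|$ as we wish: for every $\theta>0$ it can be chosen so that in addition $(1-\theta)\|x\|\le|\!|\!|x|\!|\!|\le(1+\theta)\|x\|$ for all $x\in X$.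
   Context: $\Gamma(X)$ is the class of lower semicontinuous convex proper functions $f:X\to\mathbb R\cup\{+\infty\}$ (proper: not identically $+\infty$); $\operatorname{dom}(f)=\{x:f(x)<+\infty\}$. A function $f$ is $\varepsilon$-uniformly convex if there is $\delta>0$ such that $f\left(\frac{x+y}{2}\right)\le\frac{f(x)+f(y)}{2}-\delta$ whenever $\|x-y\|\ge\varepsilon$ (vacuous if $x$ or $y$ is not in $\operatorname{dom}(f)$). *)

theory Defs
  imports "HOL-Analysis.Analysis"
begin

definition effective_domain :: "('a \<Rightarrow> ereal) \<Rightarrow> 'a set" where
  "effective_domain f = {x. f x < \<infinity>}"

definition lower_semicontinuous :: "('a::topological_space \<Rightarrow> ereal) \<Rightarrow> bool" where
  "lower_semicontinuous f \<longleftrightarrow> (\<forall>x. f x \<le> Liminf (at x) f)"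

text \<open>Used only for functions avoiding \<open>-\<infinity>\<close>, so that no sum \<open>\<infinity> + (-\<infinity>)\<close> occurs.
  The endpoints of the interval are harmless since \<open>0 * \<infinity> = 0\<close> in \<^typ>\<open>ereal\<close>.\<close>

definition convex_ereal :: "('a::real_vector \<Rightarrow> ereal) \<Rightarrow> bool" where
  "convex_ereal f \<longleftrightarrow>
    (\<forall>x y. \<forall>u\<in>{0..1::real}.
      f ((1 - u) *\<^sub>R x + u *\<^sub>R y) \<le> ereal (1 - u) * f x + ereal u * f y)"

text \<open>The class \<open>\<Gamma>(X)\<close>: the first conjunct says that \<open>f\<close> takes values in
  \<open>\<real> \<union> {+\<infinity>}\<close>, the second that \<open>f\<close> is proper.\<close>

definition proper_lsc_convex :: "('a::real_normed_vector \<Rightarrow> ereal) set" where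
  "proper_lsc_convex = {f. (\<forall>x. f x \<noteq> -\<infinity>) \<and> (\<exists>x. f x \<noteq> \<infinity>) \<and>
     lower_semicontinuous f \<and> convex_ereal f}"

text \<open>If \<open>f x = \<infinity>\<close> or \<open>f y = \<infinity>\<close> then the right-hand side is \<open>\<infinity>\<close> and the inequality is vacuous.\<close>

definition eps_uniformly_convex :: "real \<Rightarrow> ('a::real_normed_vector \<Rightarrow> ereal) \<Rightarrow> bool" where
  "eps_uniformly_convex \<epsilon> f \<longleftrightarrow>
    (\<exists>\<delta>::real. \<delta> > 0 \<and> (\<forall>x y. norm (x - y) \<ge> \<epsilon> \<longrightarrow>
      f (midpoint x y) \<le> (f x + f y) / 2 - ereal \<delta>))"

definition equivalent_norm :: "('a::real_normed_vector \<Rightarrow> real) \<Rightarrow> bool" where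
  "equivalent_norm N \<longleftrightarrow>
    (\<forall>x. N x = 0 \<longleftrightarrow> x = 0) \<and>
    (\<forall>c x. N (c *\<^sub>R x) = \<bar>c\<bar> * N x) \<and>
    (\<forall>x y. N (x + y) \<le> N x + N y) \<and>
    (\<exists>m>0. \<exists>M>0. \<forall>x. m * norm x \<le> N x \<and> N x \<le> M * norm x)"

text \<open>Distances are measured in the original norm of the space, also when \<open>g\<close> is
  built from another norm.\<close>

definition eps_plus_uniformly_convex_on ::
    "real \<Rightarrow> 'a::real_normed_vector set \<Rightarrow> ('a \<Rightarrow> real) \<Rightarrow> bool" where
  "eps_plus_uniformly_convex_on \<epsilon> A g \<longleftrightarrow>
    (\<forall>\<epsilon>'>\<epsilon>. \<exists>\<delta>>0. \<forall>x\<in>A. \<forall>y\<in>A. norm (x - y) \<ge> \<epsilon>' \<longrightarrow>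
      g (midpoint x y) \<le> (g x + g y) / 2 - \<delta>)"

end

theory Submission
  imports Defs
begin

text \<open>
  A convex function is turned into a norm by passing to the Minkowski functionals of its level
  sets, which requires the function to be even, finite and continuous; \<open>f\<close> need be none of these. The
  remedy rests on one remark: adding an arbitrary finite convex function to a function with a
  midpoint gap does not destroy the gap. So once \<open>f\<close> is replaced by a finite convex function
  \<open>F\<close>, the even function \<open>H x = F x + F (- x)\<close> still has the gap of \<open>F\<close>, even where
  the domain of \<open>f\<close> does not meet its reflection.

  The finite functions are the Lipschitz envelopes \<open>F\<^sub>n x = inf {f y + n * norm (x - y)}\<close>. At a point
  of \<open>{f \<le> a}\<close> a nearly optimal \<open>y\<close> lies within \<open>O(1 / n)\<close>, because \<open>f\<close> is bounded below;
  hence \<open>F\<^sub>n\<close> inherits the gap \<open>\<delta>\<close> of \<open>f\<close> for pairs in \<open>{f \<le> a}\<close> at distance at least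
  \<open>\<epsilon> + O(1 / n)\<close> (\<open>lipschitz_envelope_midpoint_gap\<close>). This is where \<open>\<epsilon>\<close> has to be enlarged to
  \<open>\<epsilon>' > \<epsilon>\<close>. That \<open>f\<close> is bounded below with bounded sublevel sets is a consequence of the gap: it
  quadruples when the distance doubles, so \<open>f\<close> grows quadratically and beats the linear minorant
  supplied by lower semicontinuity (\<open>midpoint_gap_imp_coercive\<close>).

  Let \<open>H\<^sub>n\<close> be the even function built from \<open>F\<^sub>n\<close>. If \<open>H\<^sub>n\<close> has the gap \<open>\<delta>\<close> at a pair
  \<open>x\<close>, \<open>y\<close> with \<open>H\<^sub>n x \<le> H\<^sub>n y\<close>, take a level \<open>b\<close> from the grid \<open>H\<^sub>n 0 + k * \<delta> / 2\<close> just
  below \<open>H\<^sub>n y\<close>. The Minkowski functional \<open>p\<close> of \<open>{H\<^sub>n < b}\<close> satisfies \<open>p y \<ge> 1\<close>, while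
  at the midpoint it is smaller than \<open>1\<close> by a definite amount. Whatever the value \<open>p x\<close> is, this
  forces a gap for \<open>p\<^sup>2\<close> (\<open>square_midpoint_gap\<close>). On a bounded set only finitely many levels
  of the grid occur, so one positive gap serves all pairs (\<open>level_seminorm_midpoint_gap\<close>).

  The new norm is the square root of \<open>(norm x)\<^sup>2\<close> plus \<open>\<theta>\<close> times a convergent weighted sum of the
  squares of all these functionals, scaled to be at most \<open>norm\<close>, over \<open>n\<close> and
  \<open>k\<close>. Each square is midpoint convex, so a gap of a single one survives, multiplied by its weight (\<open>equivalent_norm_from_seminorms\<close>).
\<close>

section \<open>Coercivity\<close>

text \<open>
  Lower semicontinuity enters only through the lower bound \<open>g x0 - 1\<close> near \<open>x0\<close>; convexity along
  the segment from \<open>x0\<close> to \<open>y\<close> propagates it to a linear bound. This minorant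
  plays the role of a supporting functional.
\<close>

lemma convex_lsc_linear_minorant:
  fixes g :: "'a::real_normed_vector \<Rightarrow> real"
  assumes convex: "convex_on D g" and x0: "x0 \<in> D" and "r > 0"
    and near: "\<And>z. z \<in> D \<Longrightarrow> dist z x0 < r \<Longrightarrow> g x0 - 1 \<le> g z"
    and y: "y \<in> D"
  shows "g x0 - 1 - 2 / r * norm (y - x0) \<le> g y"
proof (cases "norm (y - x0) < r")
  case True
  have "g x0 - 1 \<le> g y" using near[OF y] True by (simp add: dist_norm)
  moreover have "0 \<le> 2 / r * norm (y - x0)" using \<open>r > 0\<close> by simp
  ultimately show ?thesis by linarith
next
  case False
  define d where "d = norm (y - x0)"
  define t where "t = r / (2 * d)"
  have d: "d \<ge> r" "d > 0" using False \<open>r > 0\<close> by (auto simp: d_def)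
  have t: "0 < t" "t \<le> 1" using d \<open>r > 0\<close> by (auto simp: t_def field_simps)
  define z where "z = (1 - t) *\<^sub>R x0 + t *\<^sub>R y"
  have "z - x0 = t *\<^sub>R (y - x0)" by (simp add: z_def algebra_simps)
  then have "dist z x0 = r / 2"
    using t d \<open>r > 0\<close> by (simp add: dist_norm d_def[symmetric]) (simp add: t_def)
  moreover have "z \<in> D"
    using convex_on_imp_convex[OF convex] x0 y t unfolding z_def convex_alt by auto
  ultimately have "g x0 - 1 \<le> g z" using near \<open>r > 0\<close> by simp
  also have "g z \<le> (1 - t) * g x0 + t * g y"
    unfolding z_def using convex_onD[OF convex, of t x0 y] t x0 y by simp
  finally have "- 1 \<le> t * (g y - g x0)" by (simp add: algebra_simps)
  then have "- (1 / t) \<le> g y - g x0" using t by (simp add: field_simps)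
  then show ?thesis using \<open>r > 0\<close> d by (simp add: t_def d_def field_simps)
qed

lemma midpoint_in_convex:
  assumes "convex D" "x \<in> D" "y \<in> D"
  shows "midpoint x y \<in> D"
  using convexD[OF assms, of "1/2" "1/2"] by (simp add: midpoint_def scaleR_right_distrib)

text \<open>
  Subdivide the segment by its midpoint \<open>m\<close> and the quarter points \<open>p\<close>, \<open>q\<close>. If \<open>E\<close> is the gap at
  half the distance, the three pairs \<open>(x, m)\<close>, \<open>(m, y)\<close>, \<open>(p, q)\<close> combine to
  \<open>g m \<le> (g x + 2 * g m + g y) / 4 - 2 * E\<close>, and solving for \<open>g m\<close> gives the gap \<open>4 * E\<close>.
\<close>

lemma midpoint_gap_quadruples:
  fixes g :: "'a::real_normed_vector \<Rightarrow> real"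
  assumes "convex D"
    and gap: "\<And>x y. x \<in> D \<Longrightarrow> y \<in> D \<Longrightarrow> \<epsilon> \<le> norm (x - y) \<Longrightarrow>
            g (midpoint x y) \<le> (g x + g y) / 2 - \<delta>"
    and "x \<in> D" "y \<in> D" "2 ^ k * \<epsilon> \<le> norm (x - y)"
  shows "g (midpoint x y) \<le> (g x + g y) / 2 - 4 ^ k * \<delta>"
  using assms(3-)
proof (induction k arbitrary: x y)
  case 0
  then show ?case using gap by simp
next
  case (Suc k)
  define m where "m = midpoint x y"
  define p where "p = midpoint x m"
  define q where "q = midpoint m y"
  have D: "m \<in> D" "p \<in> D" "q \<in> D"
    unfolding m_def p_def q_def using Suc.prems \<open>convex D\<close> by (auto intro!: midpoint_in_convex)
  have half: "x - m = (1/2) *\<^sub>R (x - y)" "m - y = (1/2) *\<^sub>R (x - y)" "p - q = (1/2) *\<^sub>R (x - y)"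
    by (simp_all add: m_def p_def q_def midpoint_def algebra_simps flip: scaleR_left_distrib)
  have far: "2 ^ k * \<epsilon> \<le> norm (x - m)" "2 ^ k * \<epsilon> \<le> norm (m - y)" "2 ^ k * \<epsilon> \<le> norm (p - q)"
    unfolding half using Suc.prems by simp_all
  have "midpoint p q = m"
    by (simp add: m_def p_def q_def midpoint_def algebra_simps flip: scaleR_left_distrib)
  then have "g m \<le> (g p + g q) / 2 - 4 ^ k * \<delta>"
    using Suc.IH[OF D(2,3) far(3)] by simp
  moreover have "g p \<le> (g x + g m) / 2 - 4 ^ k * \<delta>"
    unfolding p_def using Suc.IH[OF Suc.prems(1) D(1) far(1)] .
  moreover have "g q \<le> (g m + g y) / 2 - 4 ^ k * \<delta>"
    unfolding q_def using Suc.IH[OF D(1) Suc.prems(2) far(2)] .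
  moreover have "4 ^ Suc k * \<delta> = 4 * (4 ^ k * \<delta>)" by simp
  ultimately show ?case unfolding m_def[symmetric] by argo
qed

text \<open>
  At distance \<open>d\<close> from \<open>x0\<close> the gap is at least of order \<open>d\<^sup>2\<close>. Applied to \<open>x0\<close> and \<open>y\<close>, with the
  minorant bounding \<open>g\<close> from below at their midpoint, it makes \<open>g y\<close> grow at least like
  \<open>\<alpha> * d\<^sup>2 - L * d\<close>. The weaker conclusion below already gives a lower bound for \<open>g\<close> and the
  boundedness of its sublevel sets.
\<close>

lemma midpoint_gap_imp_coercive:
  fixes g :: "'a::real_normed_vector \<Rightarrow> real"
  assumes "convex D" and "\<epsilon> > 0" and "\<delta> > 0"
    and gap: "\<And>x y. x \<in> D \<Longrightarrow> y \<in> D \<Longrightarrow> \<epsilon> \<le> norm (x - y) \<Longrightarrow>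
            g (midpoint x y) \<le> (g x + g y) / 2 - \<delta>"
    and x0: "x0 \<in> D"
    and minorant: "\<And>y. y \<in> D \<Longrightarrow> c - L * norm (y - x0) \<le> g y"
  obtains C where "\<And>y. y \<in> D \<Longrightarrow> norm (y - x0) - C \<le> g y"
proof -
  define \<alpha> where "\<alpha> = \<delta> / (2 * \<epsilon>\<^sup>2)"
  have "\<alpha> > 0" using assms by (simp add: \<alpha>_def)
  \<comment> \<open>The first entry handles \<open>d < \<epsilon>\<close>, where the gap says nothing; the second comes from
    completing the square in \<open>\<alpha> * d\<^sup>2 - (L + 1) * d\<close>.\<close>
  define C where "C = max (\<bar>1 + L\<bar> * \<epsilon> - c) ((L + 1)\<^sup>2 / (4 * \<alpha>) + g x0 - 2 * c)"
  show ?thesis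
  proof
    fix y assume y: "y \<in> D"
    define d where "d = norm (y - x0)"
    have "d \<ge> 0" by (simp add: d_def)
    show "norm (y - x0) - C \<le> g y"
    proof (cases "d < \<epsilon>")
      case True
      have "(1 + L) * d \<le> \<bar>1 + L\<bar> * \<epsilon>"
        using True \<open>d \<ge> 0\<close> by (intro mult_mono) auto
      moreover have "\<bar>1 + L\<bar> * \<epsilon> - c \<le> C" by (simp add: C_def)
      ultimately show ?thesis using minorant[OF y] by (simp add: d_def[symmetric] algebra_simps)
    next
      case False
      then have "1 \<le> d / \<epsilon>" using \<open>\<epsilon> > 0\<close> by (simp add: field_simps)
      obtain k where k: "2 ^ k \<le> d / \<epsilon>" "d / \<epsilon> < 2 ^ Suc k"
      proof -
        have "\<exists>n. d / \<epsilon> < 2 ^ n" by (rule real_arch_pow) simp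
        moreover have "\<not> d / \<epsilon> < 2 ^ 0" using \<open>1 \<le> d / \<epsilon>\<close> by simp
        ultimately obtain k where "\<not> d / \<epsilon> < 2 ^ k" "d / \<epsilon> < 2 ^ Suc k"
          using ex_least_nat_less[of "\<lambda>n. d / \<epsilon> < 2 ^ n"] by blast
        then show ?thesis using that by (meson not_less)
      qed
      have "2 ^ k * \<epsilon> \<le> norm (x0 - y)"
        using k(1) \<open>\<epsilon> > 0\<close> by (simp add: d_def norm_minus_commute field_simps)
      then have gapk: "g (midpoint x0 y) \<le> (g x0 + g y) / 2 - 4 ^ k * \<delta>"
        using midpoint_gap_quadruples[OF \<open>convex D\<close> gap x0 y] by blast
      have "midpoint x0 y - x0 = (1/2) *\<^sub>R (y - x0)"
        by (simp add: midpoint_def algebra_simps flip: scaleR_left_distrib)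
      then have half: "norm (midpoint x0 y - x0) = d / 2" by (simp add: d_def)
      then have low: "c - L * (d / 2) \<le> g (midpoint x0 y)"
        using minorant[OF midpoint_in_convex[OF \<open>convex D\<close> x0 y]] half by metis
      have "(d / \<epsilon>)\<^sup>2 \<le> (2 ^ Suc k)\<^sup>2"
        using k(2) \<open>1 \<le> d / \<epsilon>\<close> by (intro power_mono) auto
      also have "(2 ^ Suc k)\<^sup>2 = 4 * (4 ^ k :: real)"
        by (simp add: power_mult_distrib power2_eq_square flip: power_mult_distrib)
      finally have "\<delta> * (d / \<epsilon>)\<^sup>2 \<le> \<delta> * (4 * 4 ^ k)" using \<open>\<delta> > 0\<close> by simp
      then have "\<alpha> * d\<^sup>2 \<le> 2 * 4 ^ k * \<delta>" by (simp add: \<alpha>_def power_divide mult_ac)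
      moreover have "d * (L + 1) \<le> \<alpha> * d\<^sup>2 + (L + 1)\<^sup>2 / (4 * \<alpha>)"
      proof -
        have "0 \<le> (2 * \<alpha> * d - (L + 1))\<^sup>2 / (4 * \<alpha>)" using \<open>\<alpha> > 0\<close> by simp
        also have "\<dots> = \<alpha> * d\<^sup>2 + (L + 1)\<^sup>2 / (4 * \<alpha>) - d * (L + 1)"
          using \<open>\<alpha> > 0\<close> by (simp add: field_simps power2_eq_square)
        finally show ?thesis by simp
      qed
      moreover have "(L + 1)\<^sup>2 / (4 * \<alpha>) + g x0 - 2 * c \<le> C" by (simp add: C_def)
      ultimately show ?thesis using gapk low
        by (simp add: d_def[symmetric] algebra_simps)
    qed
  qed
qed

section \<open>The Lipschitz envelope\<close>

definition lipschitz_envelope :: "'a::real_normed_vector set \<Rightarrow> ('a \<Rightarrow> real) \<Rightarrow> real \<Rightarrow> 'a \<Rightarrow> real" where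
  "lipschitz_envelope D g M x = (INF y\<in>D. g y + M * norm (x - y))"

context
  fixes D :: "'a::real_normed_vector set" and g :: "'a \<Rightarrow> real" and K M :: real
  assumes nonempty: "D \<noteq> {}" and lower: "\<And>y. y \<in> D \<Longrightarrow> K \<le> g y" and M: "M > 0"
begin

lemma lipschitz_envelope_le:
  assumes "y \<in> D"
  shows "lipschitz_envelope D g M x \<le> g y + M * norm (x - y)"
  unfolding lipschitz_envelope_def
proof (rule cINF_lower[OF _ assms])
  show "bdd_below ((\<lambda>y. g y + M * norm (x - y)) ` D)"
  proof (rule bdd_belowI2)
    fix y assume "y \<in> D"
    then show "K \<le> g y + M * norm (x - y)" using lower[of y] M by (simp add: add_increasing2)
  qed
qed

lemma lipschitz_envelope_near_optimal:
  assumes "e > 0"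
  obtains y where "y \<in> D" "g y + M * norm (x - y) < lipschitz_envelope D g M x + e"
proof -
  have "Inf ((\<lambda>y. g y + M * norm (x - y)) ` D) < lipschitz_envelope D g M x + e"
    using assms by (simp add: lipschitz_envelope_def)
  then obtain v where "v \<in> (\<lambda>y. g y + M * norm (x - y)) ` D"
      "v < lipschitz_envelope D g M x + e"
    using cInf_lessD[of "(\<lambda>y. g y + M * norm (x - y)) ` D"] nonempty by auto
  then show ?thesis using that by auto
qed

lemma lipschitz_envelope_lipschitz:
  "lipschitz_envelope D g M x \<le> lipschitz_envelope D g M z + M * norm (x - z)"
proof (rule field_le_epsilon)
  fix e :: real assume "e > 0"
  then obtain y where y: "y \<in> D" "g y + M * norm (z - y) < lipschitz_envelope D g M z + e"
    using lipschitz_envelope_near_optimal by blast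
  have "M * norm (x - y) \<le> M * (norm (x - z) + norm (z - y))"
    using M norm_triangle_ineq[of "x - z" "z - y"] by simp
  then show "lipschitz_envelope D g M x \<le> lipschitz_envelope D g M z + M * norm (x - z) + e"
    using lipschitz_envelope_le[OF y(1), of x] y(2) by (simp add: algebra_simps)
qed

lemma lipschitz_envelope_convex:
  assumes "convex_on D g"
  shows "convex_on UNIV (lipschitz_envelope D g M)"
proof (rule convex_onI)
  fix t :: real and x x' :: 'a
  assume t: "0 < t" "t < 1"
  let ?F = "lipschitz_envelope D g M"
  show "?F ((1 - t) *\<^sub>R x + t *\<^sub>R x') \<le> (1 - t) * ?F x + t * ?F x'"
  proof (rule field_le_epsilon)
    fix e :: real assume "e > 0"
    obtain y where y: "y \<in> D" "g y + M * norm (x - y) < ?F x + e"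
      using lipschitz_envelope_near_optimal[OF \<open>e > 0\<close>] by blast
    obtain y' where y': "y' \<in> D" "g y' + M * norm (x' - y') < ?F x' + e"
      using lipschitz_envelope_near_optimal[OF \<open>e > 0\<close>] by blast
    let ?z = "(1 - t) *\<^sub>R y + t *\<^sub>R y'"
    have "?z \<in> D"
      using convex_on_imp_convex[OF assms] y(1) y'(1) t unfolding convex_alt by auto
    then have "?F ((1 - t) *\<^sub>R x + t *\<^sub>R x')
        \<le> g ?z + M * norm ((1 - t) *\<^sub>R x + t *\<^sub>R x' - ?z)"
      by (rule lipschitz_envelope_le)
    also have "g ?z \<le> (1 - t) * g y + t * g y'"
      using convex_onD[OF assms, of t y y'] t y y' by simp
    also have "norm ((1 - t) *\<^sub>R x + t *\<^sub>R x' - ?z)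
        \<le> (1 - t) * norm (x - y) + t * norm (x' - y')"
    proof -
      have "(1 - t) *\<^sub>R x + t *\<^sub>R x' - ?z = (1 - t) *\<^sub>R (x - y) + t *\<^sub>R (x' - y')"
        by (simp add: algebra_simps)
      then show ?thesis
        using norm_triangle_ineq[of "(1 - t) *\<^sub>R (x - y)" "t *\<^sub>R (x' - y')"] t by simp
    qed
    finally have "?F ((1 - t) *\<^sub>R x + t *\<^sub>R x')
        \<le> (1 - t) * (g y + M * norm (x - y)) + t * (g y' + M * norm (x' - y'))"
      using M by (simp add: algebra_simps)
    also have "\<dots> \<le> (1 - t) * (?F x + e) + t * (?F x' + e)"
      using t y(2) y'(2) by (intro add_mono[OF mult_left_mono mult_left_mono]) auto
    finally show "?F ((1 - t) *\<^sub>R x + t *\<^sub>R x') \<le> (1 - t) * ?F x + t * ?F x' + e"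
      by (simp add: algebra_simps)
  qed
qed (rule convex_UNIV)

text \<open>
  A point \<open>y\<close> that nearly attains the envelope at \<open>x\<close> has \<open>M * norm (x - y) \<le> a + 1 - K\<close>. So
  points \<open>x\<close>, \<open>x'\<close> at the distance required have nearly optimal points \<open>y\<close>, \<open>y'\<close> still at distance
  \<open>\<epsilon>\<close>, and the gap of \<open>g\<close> at \<open>y\<close>, \<open>y'\<close> passes to the envelope without loss: the errors
  \<open>M * norm (x - y)\<close> are part of the values of the envelope.
\<close>

lemma lipschitz_envelope_midpoint_gap:
  assumes "convex D"
    and gap: "\<And>x y. x \<in> D \<Longrightarrow> y \<in> D \<Longrightarrow> \<epsilon> \<le> norm (x - y) \<Longrightarrow>
            g (midpoint x y) \<le> (g x + g y) / 2 - \<delta>"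
    and x: "x \<in> D" "g x \<le> a" and x': "x' \<in> D" "g x' \<le> a"
    and far: "\<epsilon> + 2 * (a + 1 - K) / M \<le> norm (x - x')"
  shows "lipschitz_envelope D g M (midpoint x x')
    \<le> (lipschitz_envelope D g M x + lipschitz_envelope D g M x') / 2 - \<delta>"
proof -
  let ?F = "lipschitz_envelope D g M"
  have near: "norm (u - y) \<le> (a + 1 - K) / M"
    if "u \<in> D" "g u \<le> a" "y \<in> D" "g y + M * norm (u - y) < ?F u + e" "e \<le> 1" for u y e
  proof -
    have "?F u \<le> g u" using lipschitz_envelope_le[OF that(1), of u] by simp
    then have "M * norm (u - y) \<le> a + 1 - K" using that lower[of y] by linarith
    then show ?thesis using M by (simp add: field_simps)
  qed
  have "?F (midpoint x x') \<le> (?F x + ?F x') / 2 - \<delta> + e" if e: "0 < e" "e < 1" for e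
  proof -
    obtain y where y: "y \<in> D" "g y + M * norm (x - y) < ?F x + e"
      using lipschitz_envelope_near_optimal[OF e(1)] by blast
    obtain y' where y': "y' \<in> D" "g y' + M * norm (x' - y') < ?F x' + e"
      using lipschitz_envelope_near_optimal[OF e(1)] by blast
    have "norm (x - y) \<le> (a + 1 - K) / M" using near[OF x y] e by simp
    moreover have "norm (x' - y') \<le> (a + 1 - K) / M" using near[OF x' y'] e by simp
    moreover have "norm (x - x') \<le> norm (x - y) + norm (y - y') + norm (x' - y')"
      using norm_triangle_ineq[of "x - y" "y - y'"] norm_triangle_ineq[of "x - y'" "y' - x'"]
      by (simp add: norm_minus_commute)
    moreover have "2 * (a + 1 - K) / M = (a + 1 - K) / M + (a + 1 - K) / M" by simp
    ultimately have "\<epsilon> \<le> norm (y - y')" using far by argo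
    then have g: "g (midpoint y y') \<le> (g y + g y') / 2 - \<delta>" using gap y(1) y'(1) by blast
    have "midpoint x x' - midpoint y y' = (1/2) *\<^sub>R ((x - y) + (x' - y'))"
      by (simp add: midpoint_def algebra_simps)
    then have "norm (midpoint x x' - midpoint y y') = norm ((x - y) + (x' - y')) / 2"
      by simp
    then have "norm (midpoint x x' - midpoint y y') \<le> (norm (x - y) + norm (x' - y')) / 2"
      using norm_triangle_ineq[of "x - y" "x' - y'"] by simp
    from mult_left_mono[OF this, of M]
    have "M * norm (midpoint x x' - midpoint y y')
        \<le> (M * norm (x - y) + M * norm (x' - y')) / 2"
      using M by (simp add: distrib_left)
    moreover have "?F (midpoint x x')
        \<le> g (midpoint y y') + M * norm (midpoint x x' - midpoint y y')"
      by (rule lipschitz_envelope_le[OF midpoint_in_convex[OF \<open>convex D\<close> y(1) y'(1)]])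
    ultimately show ?thesis using g y(2) y'(2) by argo
  qed
  note small = this
  show ?thesis
  proof (rule field_le_epsilon)
    fix e :: real assume "e > 0"
    then show "?F (midpoint x x') \<le> (?F x + ?F x') / 2 - \<delta> + e"
      using small[of "min e (1/2)"] by linarith
  qed
qed

end

section \<open>Minkowski functionals\<close>

definition seminorm :: "('a::real_vector \<Rightarrow> real) \<Rightarrow> bool" where
  "seminorm p \<longleftrightarrow> (\<forall>c x. p (c *\<^sub>R x) = \<bar>c\<bar> * p x) \<and> (\<forall>x y. p (x + y) \<le> p x + p y)"

lemma seminormD:
  assumes "seminorm p"
  shows "p (c *\<^sub>R x) = \<bar>c\<bar> * p x" and "p (x + y) \<le> p x + p y"
  using assms by (auto simp: seminorm_def)

lemma seminorm_nonneg:
  assumes "seminorm p"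
  shows "0 \<le> p x"
  using seminormD(1)[OF assms, of 0 x] seminormD(1)[OF assms, of "-1" x]
    seminormD(2)[OF assms, of x "- x"] by simp

lemma seminorm_cmult:
  assumes "seminorm p" "0 \<le> a"
  shows "seminorm (\<lambda>x. a * p x)"
  unfolding seminorm_def
proof (intro conjI allI)
  fix x y
  show "a * p (x + y) \<le> a * p x + a * p y"
    using mult_left_mono[OF seminormD(2)[OF assms(1)] assms(2)] by (simp add: distrib_left)
qed (simp add: seminormD(1)[OF assms(1)])

lemma seminorm_midpoint_le:
  assumes "seminorm p"
  shows "p (midpoint x y) \<le> (p x + p y) / 2"
  using seminormD(1)[OF assms, of "1/2" "x + y"] seminormD(2)[OF assms, of x y]
  by (simp add: midpoint_def)

lemma seminorm_midpoint_square:
  assumes "seminorm p"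
  shows "(p (midpoint x y))\<^sup>2 \<le> ((p x)\<^sup>2 + (p y)\<^sup>2) / 2"
proof -
  have "(p (midpoint x y))\<^sup>2 \<le> ((p x + p y) / 2)\<^sup>2"
    by (rule power_mono[OF seminorm_midpoint_le[OF assms] seminorm_nonneg[OF assms]])
  also have "\<dots> = ((p x)\<^sup>2 + (p y)\<^sup>2) / 2 - (p x - p y)\<^sup>2 / 4"
    by (simp add: power2_eq_square field_simps)
  finally show ?thesis using zero_le_power2[of "p x - p y"] by linarith
qed

definition minkowski_functional :: "'a::real_vector set \<Rightarrow> 'a \<Rightarrow> real" where
  "minkowski_functional C x = Inf {l. 0 < l \<and> (1 / l) *\<^sub>R x \<in> C}"

lemma minkowski_functional_le:
  assumes "0 < l" "(1 / l) *\<^sub>R x \<in> C"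
  shows "minkowski_functional C x \<le> l"
  unfolding minkowski_functional_def
  by (rule cInf_lower) (use assms in \<open>auto intro!: bdd_belowI[of _ 0]\<close>)

context
  fixes C :: "'a::real_normed_vector set" and r :: real
  assumes C: "convex C" and symmetric: "\<forall>x\<in>C. - x \<in> C"
    and r: "0 < r" and ball: "ball 0 r \<subseteq> C"
begin

lemma minkowski_functional_absorbing:
  assumes "norm x < r * l" "0 < l"
  shows "(1 / l) *\<^sub>R x \<in> C"
  using assms by (intro subsetD[OF ball]) (simp add: field_simps)

lemma minkowski_functional_near_optimal:
  assumes "0 < e"
  obtains l where "0 < l" "(1 / l) *\<^sub>R x \<in> C" "l < minkowski_functional C x + e"
proof -
  let ?S = "{l. 0 < l \<and> (1 / l) *\<^sub>R x \<in> C}"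
  have "norm x < r * (norm x / r + 1)" using r by (simp add: field_simps)
  moreover have "0 < norm x / r + 1" using r by (simp add: add_nonneg_pos)
  ultimately have "norm x / r + 1 \<in> ?S" using minkowski_functional_absorbing by simp
  then have "?S \<noteq> {}" by blast
  moreover have "Inf ?S < minkowski_functional C x + e"
    using assms by (simp add: minkowski_functional_def)
  ultimately have "\<exists>l\<in>?S. l < minkowski_functional C x + e" by (rule cInf_lessD)
  then show ?thesis using that by auto
qed

lemma minkowski_functional_le_norm: "r * minkowski_functional C x \<le> norm x"
proof (rule field_le_epsilon)
  fix e :: real assume "e > 0"
  then have "minkowski_functional C x \<le> (norm x + e) / r"
    using r by (intro minkowski_functional_le minkowski_functional_absorbing)
      (auto simp: add_nonneg_pos)
  then show "r * minkowski_functional C x \<le> norm x + e"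
    using r by (simp add: field_simps)
qed

lemma minkowski_functional_ge_1:
  assumes "x \<notin> C"
  shows "1 \<le> minkowski_functional C x"
proof (rule ccontr)
  assume "\<not> 1 \<le> minkowski_functional C x"
  then obtain l where l: "0 < l" "(1 / l) *\<^sub>R x \<in> C" "l < 1"
    using minkowski_functional_near_optimal[of "1 - minkowski_functional C x" x] by auto
  have "0 \<in> C" using ball r by auto
  then have "(1 - l) *\<^sub>R 0 + l *\<^sub>R ((1 / l) *\<^sub>R x) \<in> C"
    using l by (intro convexD[OF C]) auto
  then show False using assms l by simp
qed

lemma minkowski_functional_scale_le:
  assumes "c \<noteq> 0"
  shows "minkowski_functional C (c *\<^sub>R x) \<le> \<bar>c\<bar> * minkowski_functional C x"
proof (rule field_le_epsilon)
  fix e :: real assume "e > 0"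
  then have "0 < e / \<bar>c\<bar>" using assms by simp
  then obtain l where l: "0 < l" "(1 / l) *\<^sub>R x \<in> C" "l < minkowski_functional C x + e / \<bar>c\<bar>"
    using minkowski_functional_near_optimal by blast
  have "(1 / (\<bar>c\<bar> * l)) *\<^sub>R (c *\<^sub>R x) = sgn c *\<^sub>R ((1 / l) *\<^sub>R x)"
    using assms by (simp add: sgn_if)
  also have "\<dots> \<in> C" using l(2) bspec[OF symmetric l(2)] assms by (auto simp: sgn_if)
  finally have "minkowski_functional C (c *\<^sub>R x) \<le> \<bar>c\<bar> * l"
    using l(1) assms by (intro minkowski_functional_le) auto
  also have "\<dots> \<le> \<bar>c\<bar> * (minkowski_functional C x + e / \<bar>c\<bar>)"
    using l(3) by (intro mult_left_mono) auto
  finally show "minkowski_functional C (c *\<^sub>R x) \<le> \<bar>c\<bar> * minkowski_functional C x + e"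
    using assms by (simp add: algebra_simps)
qed

lemma seminorm_minkowski_functional: "seminorm (minkowski_functional C)"
  unfolding seminorm_def
proof (intro conjI allI)
  let ?p = "minkowski_functional C"
  fix c x
  show "?p (c *\<^sub>R x) = \<bar>c\<bar> * ?p x"
  proof (cases "c = 0")
    case True
    have "0 \<in> C" using ball r by auto
    then have "{l. 0 < l \<and> (1 / l) *\<^sub>R (0::'a) \<in> C} = {0<..}" by auto
    then show ?thesis using True by (simp add: minkowski_functional_def)
  next
    case False
    have "?p x \<le> \<bar>1 / c\<bar> * ?p (c *\<^sub>R x)"
      using minkowski_functional_scale_le[of "1 / c" "c *\<^sub>R x"] False by simp
    then have "\<bar>c\<bar> * ?p x \<le> ?p (c *\<^sub>R x)" using False by (simp add: field_simps)
    then show ?thesis using minkowski_functional_scale_le[OF False, of x] by simp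
  qed
next
  let ?p = "minkowski_functional C"
  fix x y
  show "?p (x + y) \<le> ?p x + ?p y"
  proof (rule field_le_epsilon)
    fix e :: real assume "e > 0"
    then have "e / 2 > 0" by simp
    obtain l where l: "0 < l" "(1 / l) *\<^sub>R x \<in> C" "l < ?p x + e / 2"
      using minkowski_functional_near_optimal[OF \<open>e / 2 > 0\<close>] .
    obtain m where m: "0 < m" "(1 / m) *\<^sub>R y \<in> C" "m < ?p y + e / 2"
      using minkowski_functional_near_optimal[OF \<open>e / 2 > 0\<close>] .
    have "(l / (l + m)) *\<^sub>R ((1 / l) *\<^sub>R x) + (m / (l + m)) *\<^sub>R ((1 / m) *\<^sub>R y) \<in> C"
      using l m by (intro convexD[OF C]) (simp_all flip: add_divide_distrib)
    then have "(1 / (l + m)) *\<^sub>R (x + y) \<in> C"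
      using l m by (simp add: scaleR_right_distrib)
    then have "?p (x + y) \<le> l + m" using l m by (intro minkowski_functional_le) auto
    then show "?p (x + y) \<le> ?p x + ?p y + e" using l m by simp
  qed
qed

end

section \<open>Gluing countably many seminorms\<close>

text \<open>
  The triangle inequality is Minkowski's inequality for finite sums, passed to the limit.
\<close>

lemma seminorm_l2_sum:
  fixes p :: "nat \<Rightarrow> 'a::real_vector \<Rightarrow> real"
  assumes p: "\<And>i. seminorm (p i)" and summable: "\<And>x. summable (\<lambda>i. (p i x)\<^sup>2)"
  shows "seminorm (\<lambda>x. sqrt (\<Sum>i. (p i x)\<^sup>2))"
  unfolding seminorm_def
proof (intro conjI allI)
  fix c x
  have "(\<Sum>i. (p i (c *\<^sub>R x))\<^sup>2) = c\<^sup>2 * (\<Sum>i. (p i x)\<^sup>2)"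
    using seminormD(1)[OF p] suminf_mult[OF summable] by (simp add: power_mult_distrib)
  then show "sqrt (\<Sum>i. (p i (c *\<^sub>R x))\<^sup>2) = \<bar>c\<bar> * sqrt (\<Sum>i. (p i x)\<^sup>2)"
    by (simp add: real_sqrt_mult)
next
  fix x y
  have lim: "(\<lambda>n. L2_set (\<lambda>i. p i z) {..<n}) \<longlonglongrightarrow> sqrt (\<Sum>i. (p i z)\<^sup>2)" for z
    unfolding L2_set_def by (intro tendsto_real_sqrt summable_LIMSEQ summable)
  show "sqrt (\<Sum>i. (p i (x + y))\<^sup>2) \<le> sqrt (\<Sum>i. (p i x)\<^sup>2) + sqrt (\<Sum>i. (p i y)\<^sup>2)"
  proof (rule LIMSEQ_le[OF lim tendsto_add[OF lim lim]], intro exI allI impI)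
    fix n
    have "L2_set (\<lambda>i. p i (x + y)) {..<n} \<le> L2_set (\<lambda>i. p i x + p i y) {..<n}"
      by (intro L2_set_mono seminormD(2)[OF p] seminorm_nonneg[OF p])
    also have "\<dots> \<le> L2_set (\<lambda>i. p i x) {..<n} + L2_set (\<lambda>i. p i y) {..<n}"
      by (rule L2_set_triangle_ineq)
    finally show "L2_set (\<lambda>i. p i (x + y)) {..<n}
      \<le> L2_set (\<lambda>i. p i x) {..<n} + L2_set (\<lambda>i. p i y) {..<n}" .
  qed
qed

text \<open>
  The weights \<open>\<theta> * (1/2) ^ Suc i\<close> have sum \<open>\<theta>\<close>, which keeps the square of the new norm
  between the old square and \<open>1 + \<theta>\<close> times it. The deficit in the midpoint inequality of the new square is a sum of
  nonnegative deficits, so it is at least that of any one seminorm times its weight.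
\<close>

lemma equivalent_norm_from_seminorms:
  fixes q :: "nat \<Rightarrow> 'a::real_normed_vector \<Rightarrow> real"
  assumes q: "\<And>i. seminorm (q i)" and q_le: "\<And>i x. q i x \<le> norm x" and "\<theta> > 0"
  obtains N where "equivalent_norm N"
    and "\<And>x. norm x \<le> N x" and "\<And>x. N x \<le> (1 + \<theta>) * norm x"
    and "\<And>i x y d. (q i (midpoint x y))\<^sup>2 \<le> ((q i x)\<^sup>2 + (q i y)\<^sup>2) / 2 - d \<Longrightarrow>
      (N (midpoint x y))\<^sup>2 \<le> ((N x)\<^sup>2 + (N y)\<^sup>2) / 2 - \<theta> * (1/2) ^ Suc i * d"
proof -
  define w where "w i = \<theta> * (1/2) ^ Suc i" for i :: nat
  have w: "0 < w i" for i using \<open>\<theta> > 0\<close> by (simp add: w_def)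
  have w_sums: "w sums \<theta>" unfolding w_def using sums_mult[OF power_half_series, of \<theta>] by simp
  define p where "p i x = (case i of 0 \<Rightarrow> norm x | Suc j \<Rightarrow> sqrt (w j) * q j x)" for i x
  have p_simps: "p 0 x = norm x" "p (Suc i) x = sqrt (w i) * q i x" for i x
    by (simp_all add: p_def)
  have p: "seminorm (p i)" for i
  proof (cases i)
    case 0
    then show ?thesis by (simp add: p_def seminorm_def norm_triangle_ineq)
  next
    case (Suc j)
    have "p i = (\<lambda>x. sqrt (w j) * q j x)" by (simp add: p_def Suc fun_eq_iff)
    then show ?thesis using seminorm_cmult[OF q, of "sqrt (w j)" j] w[of j] by simp
  qed
  have p_Suc: "(p (Suc i) x)\<^sup>2 = w i * (q i x)\<^sup>2" for i x
    using w[of i] by (simp add: p_simps power_mult_distrib)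
  have p_le: "(p (Suc i) x)\<^sup>2 \<le> w i * (norm x)\<^sup>2" for i x
    unfolding p_Suc using w[of i] q_le[of i x] seminorm_nonneg[OF q]
    by (intro mult_left_mono power_mono) auto
  have w_norm: "(\<lambda>i. w i * (norm x)\<^sup>2) sums (\<theta> * (norm x)\<^sup>2)" for x :: 'a
    by (rule sums_mult2[OF w_sums])
  have summable_Suc: "summable (\<lambda>i. (p (Suc i) x)\<^sup>2)" for x
    by (rule summable_comparison_test'[OF sums_summable[OF w_norm[of x]]]) (use p_le in auto)
  then have summable: "summable (\<lambda>i. (p i x)\<^sup>2)" for x
    using summable_Suc_iff[of "\<lambda>i. (p i x)\<^sup>2"] by simp
  define N where "N x = sqrt (\<Sum>i. (p i x)\<^sup>2)" for x
  have seminorm: "seminorm N"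
    unfolding N_def[abs_def] by (rule seminorm_l2_sum[OF p summable])
  have N_sq: "(N x)\<^sup>2 = (\<Sum>i. (p i x)\<^sup>2)" for x
    by (simp add: N_def suminf_nonneg[OF summable])
  have N_ge: "norm x \<le> N x" for x
  proof -
    have "(norm x)\<^sup>2 \<le> (\<Sum>i. (p i x)\<^sup>2)"
      using sum_le_suminf[OF summable, of "{0}"] by (simp add: p_simps)
    then show ?thesis unfolding N_def by (simp add: real_le_rsqrt)
  qed
  have N_le: "N x \<le> (1 + \<theta>) * norm x" for x
  proof -
    have "(\<Sum>i. (p i x)\<^sup>2) = (\<Sum>i. (p (Suc i) x)\<^sup>2) + (norm x)\<^sup>2"
      using suminf_split_head[OF summable] by (simp add: p_simps)
    also have "(\<Sum>i. (p (Suc i) x)\<^sup>2) \<le> \<theta> * (norm x)\<^sup>2"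
      unfolding sums_unique[OF w_norm]
      by (rule suminf_le[OF p_le summable_Suc sums_summable[OF w_norm]])
    also have "\<theta> * (norm x)\<^sup>2 + (norm x)\<^sup>2 \<le> ((1 + \<theta>) * norm x)\<^sup>2"
      using \<open>\<theta> > 0\<close> by (simp add: power2_eq_square algebra_simps)
    finally show ?thesis unfolding N_def using \<open>\<theta> > 0\<close> by (intro real_le_lsqrt) auto
  qed
  show ?thesis
  proof (rule that[OF _ N_ge N_le])
    have "N x = 0 \<longleftrightarrow> x = 0" for x
      using N_ge[of x] N_le[of x] by auto
    then show "equivalent_norm N"
      unfolding equivalent_norm_def
    proof (intro conjI)
      show "\<exists>m>0. \<exists>M>0. \<forall>x. m * norm x \<le> N x \<and> N x \<le> M * norm x"
        using N_ge N_le \<open>\<theta> > 0\<close>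
        by (intro exI[of _ "1::real"] conjI exI[of _ "1 + \<theta>"] allI) simp_all
    qed (simp_all add: seminormD[OF seminorm])
  next
    fix i x y d
    assume gap: "(q i (midpoint x y))\<^sup>2 \<le> ((q i x)\<^sup>2 + (q i y)\<^sup>2) / 2 - d"
    define s where "s j = ((p j x)\<^sup>2 + (p j y)\<^sup>2) / 2 - (p j (midpoint x y))\<^sup>2" for j
    have s_nonneg: "0 \<le> s j" for j
      using seminorm_midpoint_square[OF p[of j], of x y] by (simp add: s_def)
    have s_sums: "s sums (((N x)\<^sup>2 + (N y)\<^sup>2) / 2 - (N (midpoint x y))\<^sup>2)"
      unfolding s_def[abs_def] N_sq
      by (intro sums_diff sums_divide sums_add summable_sums summable)
    have "w i * d \<le> s (Suc i)"
      using mult_left_mono[OF gap, of "w i"] w[of i] by (simp add: s_def p_Suc field_simps)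
    moreover have "s (Suc i) \<le> suminf s"
      using sum_le_suminf[of s "{Suc i}"] s_nonneg sums_summable[OF s_sums] by auto
    ultimately show "(N (midpoint x y))\<^sup>2 \<le> ((N x)\<^sup>2 + (N y)\<^sup>2) / 2 - \<theta> * (1/2) ^ Suc i * d"
      unfolding w_def[symmetric] using sums_unique[OF s_sums] by linarith
  qed
qed

section \<open>Level sets of an even convex function\<close>

text \<open>
  Applied to the values of a seminorm at \<open>x\<close>, \<open>y\<close> and their midpoint. Either \<open>X\<close> is at most
  \<open>1 - \<eta>\<close>, and strict convexity of the square exploits the difference between \<open>X\<close> and \<open>Y\<close>, or \<open>X\<close> exceeds \<open>1 - \<eta>\<close> and the midpoint value lies below
  the mean.
\<close>

lemma square_midpoint_gap:
  fixes X Y m \<eta> :: real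
  assumes "0 \<le> m" "m \<le> (X + Y) / 2" "m \<le> 1 - \<eta>" "1 \<le> Y" "0 \<le> \<eta>"
  shows "m\<^sup>2 \<le> (X\<^sup>2 + Y\<^sup>2) / 2 - \<eta>\<^sup>2 / 4"
proof (cases "X \<le> 1 - \<eta>")
  case True
  have "m\<^sup>2 \<le> ((X + Y) / 2)\<^sup>2" using assms by (intro power_mono)
  moreover have "\<eta>\<^sup>2 \<le> (Y - X)\<^sup>2" using assms True by (intro power_mono) auto
  moreover have "((X + Y) / 2)\<^sup>2 = (X\<^sup>2 + Y\<^sup>2) / 2 - (Y - X)\<^sup>2 / 4"
    by (simp add: power2_eq_square field_simps)
  ultimately show ?thesis by linarith
next
  case False
  have "m\<^sup>2 \<le> (1 - \<eta>)\<^sup>2" "(1 - \<eta>)\<^sup>2 \<le> X\<^sup>2" "1 \<le> Y\<^sup>2"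
    using assms False by (auto intro!: power_mono one_le_power)
  moreover have "(1 - \<eta>)\<^sup>2 = 1 - 2 * \<eta> + \<eta>\<^sup>2" by (simp add: power2_eq_square algebra_simps)
  moreover have "\<eta>\<^sup>2 \<le> \<eta>" using assms by (simp add: power2_eq_square mult_left_le)
  moreover have "0 \<le> \<eta>\<^sup>2" by simp
  ultimately show ?thesis using \<open>0 \<le> \<eta>\<close> by argo
qed

lemma convex_on_midpoint:
  assumes "convex_on S f" "x \<in> S" "y \<in> S"
  shows "f (midpoint x y) \<le> (f x + f y) / 2"
  using convex_onD[OF assms(1), of "1/2" x y] assms(2,3)
  by (simp add: midpoint_def scaleR_right_distrib)

text \<open>
  The factor is the radius of a ball contained in the level set when \<open>M\<close> is a Lipschitz constant of
  \<open>H\<close>, so it makes the functional bounded by the norm. The index starts the grid at \<open>H 0 + \<kappa>\<close>,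
  because the level set at \<open>H 0 = min H\<close> itself is empty.
\<close>

definition level_seminorm :: "('a::real_normed_vector \<Rightarrow> real) \<Rightarrow> real \<Rightarrow> real \<Rightarrow> nat \<Rightarrow> 'a \<Rightarrow> real" where
  "level_seminorm H M \<kappa> k x =
    real (Suc k) * \<kappa> / M * minkowski_functional {z. H z < H 0 + real (Suc k) * \<kappa>} x"

context
  fixes H :: "'a::real_normed_vector \<Rightarrow> real" and M \<kappa> :: real
  assumes convex: "convex_on UNIV H" and even: "\<And>x. H (- x) = H x"
    and lipschitz: "\<And>x z. H x \<le> H z + M * norm (x - z)"
    and M: "0 < M" and \<kappa>: "0 < \<kappa>"
begin

lemma level_set_convex: "Convex.convex {z. H z < b}"
proof (rule convexI)
  fix x y and u v :: real
  assume xy: "x \<in> {z. H z < b}" "y \<in> {z. H z < b}" and uv: "0 \<le> u" "0 \<le> v" "u + v = 1"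
  have "H (u *\<^sub>R x + v *\<^sub>R y) \<le> u * H x + v * H y"
    using convex uv unfolding convex_on_def by blast
  also have "\<dots> < b" using xy uv by (intro convex_bound_lt) auto
  finally show "u *\<^sub>R x + v *\<^sub>R y \<in> {z. H z < b}" by simp
qed

lemma level_set_ball: "ball 0 (real (Suc k) * \<kappa> / M) \<subseteq> {z. H z < H 0 + real (Suc k) * \<kappa>}"
proof
  fix x :: 'a assume "x \<in> ball 0 (real (Suc k) * \<kappa> / M)"
  then have "M * norm x < real (Suc k) * \<kappa>"
    using M by (simp add: pos_less_divide_eq mult.commute)
  then show "x \<in> {z. H z < H 0 + real (Suc k) * \<kappa>}" using lipschitz[of x 0] by simp
qed

lemma level_set_facts:
  "Convex.convex {z. H z < H 0 + real (Suc k) * \<kappa>}"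
  "\<forall>x\<in>{z. H z < H 0 + real (Suc k) * \<kappa>}. - x \<in> {z. H z < H 0 + real (Suc k) * \<kappa>}"
  "0 < real (Suc k) * \<kappa> / M"
  "ball 0 (real (Suc k) * \<kappa> / M) \<subseteq> {z. H z < H 0 + real (Suc k) * \<kappa>}"
  using M \<kappa> by (auto simp only: level_set_convex level_set_ball even mem_Collect_eq
      intro!: divide_pos_pos mult_pos_pos of_nat_0_less_iff[THEN iffD2] zero_less_Suc)

lemma seminorm_level_seminorm: "seminorm (level_seminorm H M \<kappa> k)"
  unfolding level_seminorm_def[abs_def]
  by (intro seminorm_cmult seminorm_minkowski_functional[OF level_set_facts] less_imp_le[OF level_set_facts(3)])

lemma level_seminorm_le_norm: "level_seminorm H M \<kappa> k x \<le> norm x"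
  unfolding level_seminorm_def by (rule minkowski_functional_le_norm[OF level_set_facts])

lemma even_convex_min: "H 0 \<le> H x"
  using convex_on_midpoint[OF convex, of x "- x"] even[of x] by (simp add: midpoint_def)

text \<open>
  Let \<open>H x \<le> H y\<close> and let \<open>b\<close> be the largest level of the grid with \<open>b \<le> H y\<close>. Then \<open>y\<close> lies
  outside \<open>{H < b}\<close>, whereas \<open>H\<close> is below \<open>b - \<kappa>\<close> at the midpoint. By the Lipschitz condition the
  midpoint stays in \<open>{H < b}\<close> when it is stretched by the factor \<open>1 + t\<close>, so its functional is at
  most \<open>1 / (1 + t)\<close>. Neither the bound on \<open>k\<close> nor the gap depends on the pair.
\<close>

lemma level_seminorm_midpoint_gap:
  assumes R: "0 < R" "norm x \<le> R" "norm y \<le> R"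
    and gap: "H (midpoint x y) \<le> (H x + H y) / 2 - 2 * \<kappa>"
  defines "t \<equiv> \<kappa> / (M * R)"
  shows "\<exists>k \<le> nat \<lfloor>M * R / \<kappa>\<rfloor>. (level_seminorm H M \<kappa> k (midpoint x y))\<^sup>2
    \<le> ((level_seminorm H M \<kappa> k x)\<^sup>2 + (level_seminorm H M \<kappa> k y)\<^sup>2) / 2
      - (\<kappa> / M)\<^sup>2 * ((t / (1 + t))\<^sup>2 / 4)"
  using R(2,3) gap
proof (induction "H x" "H y" arbitrary: x y rule: linorder_wlog)
  case sym
  then show ?case by (metis add.commute midpoint_sym)
next
  case (le x y)
  define c where "c = H y - H 0"
  define m where "m = midpoint x y"
  have t: "0 < t" using R M \<kappa> by (simp add: t_def)
  have Hm: "H m \<le> H y - 2 * \<kappa>" using le(1) le.prems(3) unfolding m_def by argo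
  \<comment> \<open>Since \<open>H m \<ge> H 0\<close>, the gap keeps \<open>H y\<close> above the lowest level of the grid.\<close>
  then have "1 \<le> c / \<kappa>" using even_convex_min[of m] \<kappa> by (simp add: c_def field_simps)
  then obtain k where k: "real (Suc k) \<le> c / \<kappa>" "c / \<kappa> < real (Suc k) + 1"
  proof -
    have "1 \<le> \<lfloor>c / \<kappa>\<rfloor>" using \<open>1 \<le> c / \<kappa>\<close> by simp
    then have "real (Suc (nat \<lfloor>c / \<kappa>\<rfloor> - 1)) = of_int \<lfloor>c / \<kappa>\<rfloor>" by simp
    then show ?thesis using that[of "nat \<lfloor>c / \<kappa>\<rfloor> - 1"] by linarith
  qed
  define b where "b = H 0 + real (Suc k) * \<kappa>"
  let ?C = "{z. H z < b}"
  let ?p = "minkowski_functional ?C"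
  have C: "H 0 + real (Suc k) * \<kappa> = b" by (simp add: b_def)
  note p = seminorm_minkowski_functional[OF level_set_facts, of k, unfolded C]
  have b: "b \<le> H y" "H y < b + \<kappa>"
    using k \<kappa> by (simp_all add: b_def c_def field_simps)
  have norm_m: "norm m \<le> R"
    using norm_triangle_ineq[of x y] le.prems by (simp add: m_def midpoint_def)
  have "y \<notin> {z. H z < H 0 + real (Suc k) * \<kappa>}" unfolding C using b(1) by simp
  then have "1 \<le> ?p y"
    unfolding C[symmetric] by (rule minkowski_functional_ge_1[OF level_set_facts])
  moreover have "?p m \<le> 1 / (1 + t)"
  proof (rule minkowski_functional_le)
    have "(1 + t) *\<^sub>R m - m = t *\<^sub>R m" by (simp add: algebra_simps)
    then have "H ((1 + t) *\<^sub>R m) \<le> H m + M * (t * norm m)"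
      using lipschitz[of "(1 + t) *\<^sub>R m" m] t by simp
    also have "M * (t * norm m) \<le> M * (t * R)"
      using M t norm_m by (intro mult_left_mono) auto
    also have "M * (t * R) = \<kappa>" using M R by (simp add: t_def)
    finally show "(1 / (1 / (1 + t))) *\<^sub>R m \<in> ?C" using Hm b by simp
  qed (use t in simp)
  moreover have "1 / (1 + t) = 1 - t / (1 + t)" using t by (simp add: field_simps)
  ultimately have p_gap: "(?p m)\<^sup>2 \<le> ((?p x)\<^sup>2 + (?p y)\<^sup>2) / 2 - (t / (1 + t))\<^sup>2 / 4"
    using t seminorm_midpoint_le[OF p, of x y] seminorm_nonneg[OF p]
    by (intro square_midpoint_gap) (auto simp: m_def)
  let ?r = "real (Suc k) * \<kappa> / M"
  have "(?r * ?p m)\<^sup>2 \<le> ((?r * ?p x)\<^sup>2 + (?r * ?p y)\<^sup>2) / 2 - ?r\<^sup>2 * ((t / (1 + t))\<^sup>2 / 4)"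
    using mult_left_mono[OF p_gap, of "?r\<^sup>2"] unfolding power_mult_distrib
    by (simp add: right_diff_distrib distrib_left)
  moreover have "(\<kappa> / M)\<^sup>2 * ((t / (1 + t))\<^sup>2 / 4) \<le> ?r\<^sup>2 * ((t / (1 + t))\<^sup>2 / 4)"
    using M \<kappa> by (intro mult_right_mono power_mono) (auto simp: field_simps)
  moreover have "k \<le> nat \<lfloor>M * R / \<kappa>\<rfloor>"
  proof -
    have "M * norm y \<le> M * R" using M le.prems by simp
    then have "c \<le> M * R" using lipschitz[of y 0] by (simp add: c_def)
    then have "c / \<kappa> \<le> M * R / \<kappa>" using \<kappa> by (simp add: divide_right_mono)
    then have "real k \<le> M * R / \<kappa>" using k(1) by simp
    then show ?thesis by (simp add: le_nat_floor)
  qed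
  ultimately show ?case unfolding level_seminorm_def m_def
    by (intro exI[of _ k] conjI) (assumption, unfold C, linarith)
qed

end

section \<open>The renorming\<close>

text \<open>
  The seminorms are indexed by the pairs of an envelope and a level. For given \<open>a\<close> and \<open>\<epsilon>'\<close> one
  envelope \<open>n\<close> is fine enough for all pairs of points, and only finitely many levels \<open>k\<close> occur, so
  the weights of the seminorms used have a positive lower bound.
\<close>

lemma renorming_from_coercive_convex:
  fixes g :: "'a::real_normed_vector \<Rightarrow> real"
  assumes g: "convex_on D g" and x0: "x0 \<in> D" and "\<delta> > 0"
    and gap: "\<And>x y. x \<in> D \<Longrightarrow> y \<in> D \<Longrightarrow> \<epsilon> \<le> norm (x - y) \<Longrightarrow>
            g (midpoint x y) \<le> (g x + g y) / 2 - \<delta>"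
    and coercive: "\<And>y. y \<in> D \<Longrightarrow> norm (y - x0) - C \<le> g y"
    and "\<theta> > 0"
  obtains N where "equivalent_norm N" "\<And>x. norm x \<le> N x" "\<And>x. N x \<le> (1 + \<theta>) * norm x"
    "\<And>a. eps_plus_uniformly_convex_on \<epsilon> {x\<in>D. g x \<le> a} (\<lambda>x. (N x)\<^sup>2)"
proof -
  have D: "D \<noteq> {}" "convex D" using x0 convex_on_imp_convex[OF g] by auto
  have lower: "- C \<le> g y" if "y \<in> D" for y
    using coercive[OF that] norm_ge_zero[of "y - x0"] by linarith
  \<comment> \<open>\<open>Suc n\<close> since the Lipschitz constant must be positive\<close>
  define F where "F n = lipschitz_envelope D g (real (Suc n))" for n
  define H where "H n x = F n x + F n (- x)" for n x
  define M where "M n = 2 * real (Suc n)" for n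
  \<comment> \<open>Half the gap, so that a level of the grid fits between the values at the midpoint and at \<open>y\<close>.\<close>
  define \<kappa> where "\<kappa> = \<delta> / 2"
  have M: "0 < M n" for n by (simp add: M_def)
  have \<kappa>: "0 < \<kappa>" using \<open>\<delta> > 0\<close> by (simp add: \<kappa>_def)
  have F: "convex_on UNIV (F n)" for n
    unfolding F_def by (rule lipschitz_envelope_convex[OF D(1) lower _ g]) auto
  have F_lip: "F n x \<le> F n z + real (Suc n) * norm (x - z)" for n x z
    unfolding F_def by (rule lipschitz_envelope_lipschitz[OF D(1) lower]) auto
  have H_even: "H n (- x) = H n x" for n x by (simp add: H_def)
  have H_lip: "H n x \<le> H n z + M n * norm (x - z)" for n x z
    using F_lip[of n x z] F_lip[of n "- x" "- z"] norm_minus_commute[of x z]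
    by (simp add: H_def M_def algebra_simps)
  have F_neg: "convex_on UNIV (\<lambda>x. F n (- x))" for n
  proof (rule convex_onI)
    fix t :: real and x y :: 'a
    assume "0 < t" "t < 1"
    then show "F n (- ((1 - t) *\<^sub>R x + t *\<^sub>R y)) \<le> (1 - t) * F n (- x) + t * F n (- y)"
      using convex_onD[OF F, of t "- x" "- y"] by simp
  qed simp
  have H: "convex_on UNIV (H n)" for n
    unfolding H_def[abs_def] by (rule convex_on_add[OF F F_neg])
  note facts = H H_even H_lip M \<kappa>
  define q where "q i = (case prod_decode i of (n, k) \<Rightarrow> level_seminorm (H n) (M n) \<kappa> k)" for i
  have q_encode: "q (prod_encode (n, k)) = level_seminorm (H n) (M n) \<kappa> k" for n k
    by (simp add: q_def)
  have "seminorm (q i)" for i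
    unfolding q_def by (cases "prod_decode i") (simp add: seminorm_level_seminorm[OF facts])
  moreover have "q i x \<le> norm x" for i x
    unfolding q_def by (cases "prod_decode i") (simp add: level_seminorm_le_norm[OF facts])
  ultimately obtain N where N: "equivalent_norm N" "\<And>x. norm x \<le> N x"
      "\<And>x. N x \<le> (1 + \<theta>) * norm x"
    and N_gap: "\<And>i x y d. (q i (midpoint x y))\<^sup>2 \<le> ((q i x)\<^sup>2 + (q i y)\<^sup>2) / 2 - d \<Longrightarrow>
      (N (midpoint x y))\<^sup>2 \<le> ((N x)\<^sup>2 + (N y)\<^sup>2) / 2 - \<theta> * (1/2) ^ Suc i * d"
    using equivalent_norm_from_seminorms[OF _ _ \<open>\<theta> > 0\<close>, of q] by metis
  have "eps_plus_uniformly_convex_on \<epsilon> {x\<in>D. g x \<le> a} (\<lambda>x. (N x)\<^sup>2)" for a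
    unfolding eps_plus_uniformly_convex_on_def
  proof (intro allI impI)
    fix \<epsilon>' assume "\<epsilon>' > \<epsilon>"
    define R where "R = \<bar>a + C\<bar> + norm x0 + 1"
    have R: "0 < R" by (simp add: R_def add_nonneg_pos)
    have norm_R: "norm x \<le> R" if "x \<in> D" "g x \<le> a" for x
      using coercive[OF that(1)] that(2) norm_triangle_sub[of x x0] by (simp add: R_def)
    obtain n where "2 * (a + 1 + C) / (\<epsilon>' - \<epsilon>) < real n" using reals_Archimedean2 by blast
    then have "2 * (a + 1 + C) < real n * (\<epsilon>' - \<epsilon>)"
      using \<open>\<epsilon>' > \<epsilon>\<close> by (simp add: pos_divide_less_eq)
    also have "\<dots> \<le> real (Suc n) * (\<epsilon>' - \<epsilon>)"
      using \<open>\<epsilon>' > \<epsilon>\<close> by (intro mult_right_mono) auto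
    finally have n: "\<epsilon> + 2 * (a + 1 - - C) / real (Suc n) \<le> \<epsilon>'"
      by (simp add: field_simps)
    define t where "t = \<kappa> / (M n * R)"
    define d where "d = (\<kappa> / M n)\<^sup>2 * ((t / (1 + t))\<^sup>2 / 4)"
    have t: "0 < t" using \<kappa> M R by (simp add: t_def)
    have d: "0 < d" using \<kappa> M[of n] t by (simp add: d_def)
    define K where "K = nat \<lfloor>M n * R / \<kappa>\<rfloor>"
    define I where "I = Max ((\<lambda>k. prod_encode (n, k)) ` {..K})"
    have I: "prod_encode (n, k) \<le> I" if "k \<le> K" for k
      unfolding I_def using that by (intro Max_ge) auto
    show "\<exists>\<delta>>0. \<forall>x\<in>{x \<in> D. g x \<le> a}. \<forall>y\<in>{x \<in> D. g x \<le> a}. \<epsilon>' \<le> norm (x - y) \<longrightarrow>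
      (N (midpoint x y))\<^sup>2 \<le> ((N x)\<^sup>2 + (N y)\<^sup>2) / 2 - \<delta>"
    proof (intro exI conjI ballI impI)
      show "0 < \<theta> * (1/2) ^ Suc I * d" using \<open>\<theta> > 0\<close> d by simp
      fix x y
      assume "x \<in> {x \<in> D. g x \<le> a}" "y \<in> {x \<in> D. g x \<le> a}" and far: "\<epsilon>' \<le> norm (x - y)"
      then have x: "x \<in> D" "g x \<le> a" and y: "y \<in> D" "g y \<le> a" by auto
      have "F n (midpoint x y) \<le> (F n x + F n y) / 2 - \<delta>"
        unfolding F_def
        by (rule lipschitz_envelope_midpoint_gap[OF D(1) lower _ D(2) gap x y])
          (use n far in auto)
      moreover have "F n (- midpoint x y) \<le> (F n (- x) + F n (- y)) / 2"
        using convex_on_midpoint[OF F_neg] by blast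
      ultimately have "H n (midpoint x y) \<le> (H n x + H n y) / 2 - 2 * \<kappa>"
        by (simp add: H_def \<kappa>_def add_divide_distrib)
      then obtain k where k: "k \<le> K"
        "(q (prod_encode (n, k)) (midpoint x y))\<^sup>2
          \<le> ((q (prod_encode (n, k)) x)\<^sup>2 + (q (prod_encode (n, k)) y)\<^sup>2) / 2 - d"
        using level_seminorm_midpoint_gap[OF facts R norm_R[OF x] norm_R[OF y]]
        unfolding q_encode K_def d_def t_def by blast
      have "\<theta> * (1/2) ^ Suc I * d \<le> \<theta> * (1/2) ^ Suc (prod_encode (n, k)) * d"
        using I[OF k(1)] \<open>\<theta> > 0\<close> d
        by (intro mult_right_mono mult_left_mono power_decreasing) auto
      then show "(N (midpoint x y))\<^sup>2 \<le> ((N x)\<^sup>2 + (N y)\<^sup>2) / 2 - \<theta> * (1/2) ^ Suc I * d"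
        using N_gap[OF k(2)] by linarith
    qed
  qed
  then show ?thesis using that N by blast
qed


theorem theorem1p4:
  fixes f :: "'a::banach \<Rightarrow> ereal" and \<epsilon> :: real
  assumes "\<epsilon> > 0" and "f \<in> proper_lsc_convex" and "eps_uniformly_convex \<epsilon> f"
  shows "(\<exists>N. equivalent_norm N \<and>
            (\<forall>A. A \<subseteq> effective_domain f \<and> (SUP x\<in>A. f x) < \<infinity> \<longrightarrow>
              eps_plus_uniformly_convex_on \<epsilon> A (\<lambda>x. (N x)\<^sup>2))) \<and>
         (\<forall>\<theta>>0. \<exists>N. equivalent_norm N \<and>
            (\<forall>A. A \<subseteq> effective_domain f \<and> (SUP x\<in>A. f x) < \<infinity> \<longrightarrow>
              eps_plus_uniformly_convex_on \<epsilon> A (\<lambda>x. (N x)\<^sup>2)) \<and>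
            (\<forall>x. (1 - \<theta>) * norm x \<le> N x \<and> N x \<le> (1 + \<theta>) * norm x))"
proof -
  define D where "D = effective_domain f"
  define g where "g x = real_of_ereal (f x)" for x
  have f_lsc: "lower_semicontinuous f" and f_convex: "convex_ereal f"
    using assms(2) by (auto simp: proper_lsc_convex_def)
  have no_minf: "f x \<noteq> -\<infinity>" for x
    using assms(2) by (auto simp: proper_lsc_convex_def)
  have f_eq: "f x = ereal (g x)" if "x \<in> D" for x
    using that no_minf[of x] unfolding D_def effective_domain_def g_def by (cases "f x") auto
  obtain x0 where x0: "x0 \<in> D"
    using assms(2) by (auto simp: proper_lsc_convex_def D_def effective_domain_def)
  have f_le: "x \<in> D \<and> g x \<le> c" if "f x \<le> ereal c" for x c
    using that no_minf[of x] unfolding D_def effective_domain_def g_def by (cases "f x") auto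
  have g_convex: "(1 - u) *\<^sub>R x + u *\<^sub>R y \<in> D \<and>
      g ((1 - u) *\<^sub>R x + u *\<^sub>R y) \<le> (1 - u) * g x + u * g y"
    if "x \<in> D" "y \<in> D" "0 \<le> u" "u \<le> 1" for x y u
  proof (rule f_le)
    show "f ((1 - u) *\<^sub>R x + u *\<^sub>R y) \<le> ereal ((1 - u) * g x + u * g y)"
      using f_convex that f_eq[of x] f_eq[of y] unfolding convex_ereal_def
      by (metis atLeastAtMost_iff plus_ereal.simps(1) times_ereal.simps(1))
  qed
  have D: "convex D" unfolding convex_alt using g_convex by blast
  have g: "convex_on D g" using g_convex D by (intro convex_onI) auto
  obtain \<delta> where \<delta>: "\<delta> > 0"
    and f_gap: "\<And>x y. norm (x - y) \<ge> \<epsilon> \<Longrightarrow> f (midpoint x y) \<le> (f x + f y) / 2 - ereal \<delta>"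
    using assms(3) unfolding eps_uniformly_convex_def by blast
  have gap: "g (midpoint x y) \<le> (g x + g y) / 2 - \<delta>"
    if "x \<in> D" "y \<in> D" "\<epsilon> \<le> norm (x - y)" for x y
    using f_le[of "midpoint x y" "(g x + g y) / 2 - \<delta>"] f_gap[OF that(3)]
      f_eq[OF that(1)] f_eq[OF that(2)] by simp
  have "ereal (g x0 - 1) < f x0" using f_eq[OF x0] by simp
  moreover have "f x0 \<le> Liminf (at x0) f"
    using f_lsc by (simp add: lower_semicontinuous_def)
  ultimately have "\<forall>\<^sub>F z in at x0. ereal (g x0 - 1) < f z"
    by (simp add: le_Liminf_iff)
  then obtain r where r: "r > 0" "\<And>z. z \<noteq> x0 \<Longrightarrow> dist z x0 < r \<Longrightarrow> ereal (g x0 - 1) < f z"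
    unfolding eventually_at by auto
  have near: "g x0 - 1 \<le> g z" if "z \<in> D" "dist z x0 < r" for z
    using r(2)[of z] that f_eq[OF that(1)] by (cases "z = x0") auto
  obtain C where C: "\<And>y. y \<in> D \<Longrightarrow> norm (y - x0) - C \<le> g y"
    using midpoint_gap_imp_coercive[OF D \<open>\<epsilon> > 0\<close> \<delta> gap x0
        convex_lsc_linear_minorant[OF g x0 r(1) near]] by blast
  have sublevel: "\<exists>a. A \<subseteq> {x\<in>D. g x \<le> a}" if "A \<subseteq> effective_domain f \<and> (SUP x\<in>A. f x) < \<infinity>" for A
  proof -
    from that obtain a where a: "(SUP x\<in>A. f x) \<le> ereal a"
      using ereal_dense2[of "SUP x\<in>A. f x" \<infinity>] by (blast intro: order_less_imp_le)
    have "x \<in> D \<and> g x \<le> a" if "x \<in> A" for x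
      using SUP_upper[OF that, of f] a by (intro f_le) (rule order_trans)
    then show ?thesis by blast
  qed
  have renorming: "\<exists>N. equivalent_norm N \<and>
      (\<forall>A. A \<subseteq> effective_domain f \<and> (SUP x\<in>A. f x) < \<infinity> \<longrightarrow>
        eps_plus_uniformly_convex_on \<epsilon> A (\<lambda>x. (N x)\<^sup>2)) \<and>
      (\<forall>x. (1 - \<theta>) * norm x \<le> N x \<and> N x \<le> (1 + \<theta>) * norm x)" if "\<theta> > 0" for \<theta>
  proof -
    obtain N where N: "equivalent_norm N" "\<And>x. norm x \<le> N x" "\<And>x. N x \<le> (1 + \<theta>) * norm x"
      and uc: "\<And>a. eps_plus_uniformly_convex_on \<epsilon> {x\<in>D. g x \<le> a} (\<lambda>x. (N x)\<^sup>2)"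
      using renorming_from_coercive_convex[OF g x0 \<delta> gap C \<open>\<theta> > 0\<close>] by blast
    have "(1 - \<theta>) * norm x \<le> N x" for x
    proof -
      have "(1 - \<theta>) * norm x \<le> 1 * norm x" using that by (intro mult_right_mono) auto
      then show ?thesis using N(2)[of x] by simp
    qed
    moreover have "eps_plus_uniformly_convex_on \<epsilon> A (\<lambda>x. (N x)\<^sup>2)"
      if "A \<subseteq> effective_domain f \<and> (SUP x\<in>A. f x) < \<infinity>" for A
    proof -
      from sublevel[OF that] obtain a where "A \<subseteq> {x\<in>D. g x \<le> a}" by blast
      then show ?thesis using uc[of a] unfolding eps_plus_uniformly_convex_on_def by (meson subsetD)
    qed
    ultimately show ?thesis using N(1,3) by (intro exI[of _ N]) simp
  qed
  show ?thesis
  proof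
    show "\<exists>N. equivalent_norm N \<and>
      (\<forall>A. A \<subseteq> effective_domain f \<and> (SUP x\<in>A. f x) < \<infinity> \<longrightarrow>
        eps_plus_uniformly_convex_on \<epsilon> A (\<lambda>x. (N x)\<^sup>2))"
      using renorming[of 1] by auto
  qed (use renorming in blast)
qed

end
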